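(* Let $\mathbb{F}=\mathbb{R}$ or $\mathbb{C}$, let $F=\{f_i\}_{i=1}^k$ be a frame for $\mathbb{F}^n$, and let $\tilde F=\{\tilde f_i\}_{i=1}^k$ be the canonical dual frame for $F$. Then the cross frame potential of $\tilde F$ with respect to $F$ is equal to $n$, that is, $$P_F(\tilde F)=\sum_{i=1}^k\sum_{j=1}^k|\langle f_i,\tilde f_j\rangle|^2=n.$$
   Context: A frame for $\mathbb{F}^n$ is a finite sequence $\{f_i\}_{i=1}^k$ ($k\ge n$) of vectors for which there are constants $0<A\le B<\infty$ with $A\|f\|^2\le\sum_{i=1}^k|\langle f,f_i\rangle|^2\le B\|f\|^2$ for all $f\in\mathbb{F}^n$ (equivalently, a spanning sequence). The frame operator of $F$ is $Sf=\sum_{i=1}^k\langle f,f_i\rangle f_i$, which is positive, self-adjoint and invertible; the canonical dual frame of $F$ is $\tilde F=\{S^{-1}f_i\}_{i=1}^k$. The cross frame potential of a frame $G=\{g_i\}_{i=1}^k$ with respect to $F$ is $P_F(G)=\sum_{i=1}^k\sum_{j=1}^k|\langle f_i,g_j\rangle|^2$. *)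

theory Defs
  imports "HOL-Analysis.Analysis" "Jordan_Normal_Form.Conjugate"
begin

text \<open>
  The scalar field is a type \<open>'a\<close>, to be instantiated by \<^typ>\<open>real\<close> and by \<^typ>\<open>complex\<close>, on
  which \<^const>\<open>conjugate\<close> is the identity and complex conjugation, respectively. The library's
  \<^const>\<open>inner\<close> is real-valued also on complex vectors, hence the following \<open>'a\<close>-valued inner
  product; it is linear in the first and conjugate-linear in the second argument.
\<close>

definition hinner ::
  "('a::{conjugatable_field,real_normed_field}) ^ 'n \<Rightarrow> 'a ^ 'n \<Rightarrow> 'a" where
  "hinner x y = (\<Sum>i\<in>UNIV. x $ i * conjugate (y $ i))"

lemma hinner_self_real: "hinner x x = (norm x)\<^sup>2" for x :: "real ^ 'n"
  by (simp add: hinner_def norm_vec_def L2_set_def sum_nonneg power2_eq_square[symmetric])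

lemma hinner_self_complex: "hinner x x = of_real ((norm x)\<^sup>2)" for x :: "complex ^ 'n"
  by (simp add: hinner_def norm_vec_def L2_set_def sum_nonneg complex_mult_cnj cmod_def)

text \<open>
  A sequence of \<open>k\<close> vectors is given by a function on \<^typ>\<open>nat\<close>, of which only the values at
  \<open>1, \<dots>, k\<close> matter.
\<close>

definition is_frame ::
  "nat \<Rightarrow> (nat \<Rightarrow> ('a::{conjugatable_field,real_normed_field}) ^ 'n) \<Rightarrow> bool" where
  "is_frame k f \<longleftrightarrow> CARD('n) \<le> k \<and>
    (\<exists>A B :: real. 0 < A \<and> A \<le> B \<and>
      (\<forall>v. A * (norm v)\<^sup>2 \<le> (\<Sum>i=1..k. (norm (hinner v (f i)))\<^sup>2) \<and>
           (\<Sum>i=1..k. (norm (hinner v (f i)))\<^sup>2) \<le> B * (norm v)\<^sup>2))"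

definition frame_operator ::
  "nat \<Rightarrow> (nat \<Rightarrow> ('a::{conjugatable_field,real_normed_field}) ^ 'n) \<Rightarrow> 'a ^ 'n \<Rightarrow> 'a ^ 'n" where
  "frame_operator k f v = (\<Sum>i=1..k. hinner v (f i) *s f i)"

text \<open>For a frame, \<^const>\<open>frame_operator\<close> is bijective, so \<^const>\<open>inv\<close> is its inverse.\<close>

definition canonical_dual ::
  "nat \<Rightarrow> (nat \<Rightarrow> ('a::{conjugatable_field,real_normed_field}) ^ 'n) \<Rightarrow> nat \<Rightarrow> 'a ^ 'n" where
  "canonical_dual k f i = inv (frame_operator k f) (f i)"

text \<open>The cross frame potential of \<open>g\<close> with respect to \<open>f\<close>.\<close>

definition cross_frame_potential ::
  "nat \<Rightarrow> (nat \<Rightarrow> ('a::{conjugatable_field,real_normed_field}) ^ 'n) \<Rightarrow> (nat \<Rightarrow> 'a ^ 'n) \<Rightarrow> real" where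
  "cross_frame_potential k f g = (\<Sum>i=1..k. \<Sum>j=1..k. (norm (hinner (f i) (g j)))\<^sup>2)"

end

theory Submission
  imports Defs
begin

text \<open>
  With \<open>T\<close> the inverse of the self-adjoint frame operator \<open>S\<close>, the potential equals
  \<open>\<Sum>\<^sub>i \<langle>S (T f\<^sub>i), T f\<^sub>i\<rangle> = \<Sum>\<^sub>i \<langle>T f\<^sub>i, f\<^sub>i\<rangle>\<close>, which is the trace of \<open>T S\<close>, the identity.
\<close>

lemma hinner_commute: "hinner y x = conjugate (hinner x y)"
  by (simp add: hinner_def sum_conjugate conjugate_dist_mul mult.commute)

text \<open>The matrix \<open>F F*\<close> whose factor \<open>F\<close> has the frame vectors as
  columns. Matrix form gives access to one-sided inverses and to the trace.\<close>

definition frame_matrix ::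
  "nat \<Rightarrow> (nat \<Rightarrow> ('a::{conjugatable_field,real_normed_field}) ^ 'n) \<Rightarrow> 'a ^ 'n ^ 'n" where
  "frame_matrix k f = (\<chi> a b. \<Sum>i=1..k. f i $ a * conjugate (f i $ b))"

lemma frame_operator_eq_matrix: "frame_operator k f v = frame_matrix k f *v v"
  by (simp add: vec_eq_iff frame_operator_def frame_matrix_def matrix_vector_mult_def hinner_def
      sum_distrib_left sum_distrib_right mult_ac sum.swap[of _ UNIV])

lemma hinner_sum_left: "hinner (\<Sum>i\<in>A. c i *s x i) y = (\<Sum>i\<in>A. c i * hinner (x i) y)"
  by (simp add: hinner_def sum_distrib_left sum_distrib_right mult_ac sum.swap[of _ UNIV])

lemma hinner_frame_operator_left:
  "hinner (frame_operator k f x) y = (\<Sum>i=1..k. hinner x (f i) * hinner (f i) y)"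
  unfolding frame_operator_def by (rule hinner_sum_left)

lemma frame_operator_self_adjoint:
  "hinner (frame_operator k f x) y = hinner x (frame_operator k f y)"
proof -
  have "hinner x (frame_operator k f y) = conjugate (hinner (frame_operator k f y) x)"
    by (rule hinner_commute)
  also have "\<dots> = (\<Sum>i=1..k. conjugate (hinner y (f i)) * conjugate (hinner (f i) x))"
    by (simp add: hinner_frame_operator_left sum_conjugate conjugate_dist_mul)
  also have "\<dots> = hinner (frame_operator k f x) y"
    by (simp add: hinner_frame_operator_left hinner_commute[symmetric] mult.commute)
  finally show ?thesis by simp
qed

text \<open>The type classes do not link \<open>conjugate\<close> to \<open>norm\<close>. Assuming
  \<open>norm_conjugate\<close> supplies that link, so that one argument serves both scalar
  fields.\<close>

context
  fixes k :: nat and f :: "nat \<Rightarrow> ('a::{conjugatable_field,real_normed_field}) ^ 'n"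
  assumes norm_conjugate: "\<And>x :: 'a. x * conjugate x = of_real ((norm x)\<^sup>2)"
    and frame: "is_frame k f"
begin

lemma hinner_frame_operator_self:
  "hinner (frame_operator k f v) v = of_real (\<Sum>i=1..k. (norm (hinner v (f i)))\<^sup>2)"
  by (simp add: hinner_frame_operator_left hinner_commute[of "f i" v for i] norm_conjugate)

text \<open>A kernel vector has vanishing frame sum, so the lower frame bound forces it to be zero;
  linearity then gives injectivity.\<close>

lemma inj_frame_operator: "inj (frame_operator k f)"
proof -
  obtain A :: real where A: "0 < A"
    "\<And>v. A * (norm v)\<^sup>2 \<le> (\<Sum>i=1..k. (norm (hinner v (f i)))\<^sup>2)"
    using frame unfolding is_frame_def by blast
  have "v = 0" if "frame_operator k f v = 0" for v
  proof -
    have "(of_real (\<Sum>i=1..k. (norm (hinner v (f i)))\<^sup>2) :: 'a) = 0"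
      unfolding hinner_frame_operator_self[symmetric] that by (simp add: hinner_def)
    then have "A * (norm v)\<^sup>2 \<le> 0"
      using A(2)[of v] by (simp only: of_real_eq_0_iff)
    then show ?thesis
      using A(1) by (simp add: mult_le_0_iff)
  qed
  then have "x = y" if "frame_operator k f x = frame_operator k f y" for x y
    using that by (metis frame_operator_eq_matrix matrix_vector_mult_diff_distrib right_minus_eq)
  then show ?thesis
    by (rule injI)
qed

lemma cross_frame_potential_canonical_dual:
  "cross_frame_potential k f (canonical_dual k f) = real CARD('n)"
proof -
  define S where "S = frame_operator k f"
  define T where "T = inv S"
  obtain N where NM: "N ** frame_matrix k f = mat 1"
    using inj_frame_operator matrix_left_invertible_injective[of "frame_matrix k f"]
    unfolding frame_operator_eq_matrix[abs_def] by blast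
  have MN: "frame_matrix k f ** N = mat 1"
    using NM by (simp add: matrix_left_right_inverse)
  have S: "S v = frame_matrix k f *v v" for v
    by (simp add: S_def frame_operator_eq_matrix)
  have SN: "S (N *v v) = v" for v
    by (simp add: S matrix_vector_mul_assoc MN)
  have T: "T v = N *v v" for v
    \<comment> \<open>Apply \<open>inv S\<close> to \<open>S (N *v v) = v\<close> and cancel by
      injectivity.\<close>
    unfolding T_def using inj_frame_operator SN by (metis S_def inv_f_f)
  have S_T: "S (T v) = v" for v
    by (simp add: T SN)
  have T_adj: "hinner (T x) y = hinner x (T y)" for x y
    \<comment> \<open>Self-adjointness passes from \<open>S\<close> to its inverse: at
      \<open>T x\<close> and \<open>T y\<close>, each \<open>S\<close> cancels a
      \<open>T\<close>.\<close>
    using frame_operator_self_adjoint[of k f "T x" "T y"] by (simp add: S_T flip: S_def)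
  have "(of_real (cross_frame_potential k f (canonical_dual k f)) :: 'a)
      = (\<Sum>i=1..k. of_real (\<Sum>j=1..k. (norm (hinner (T (f i)) (f j)))\<^sup>2))"
    \<comment> \<open>Moving \<open>T\<close> from \<open>f j\<close> to \<open>f i\<close> turns
      the sum over \<open>j\<close> into the frame sum of \<open>T (f i)\<close>.\<close>
    by (simp add: cross_frame_potential_def canonical_dual_def T_adj flip: S_def T_def)
  also have "\<dots> = (\<Sum>i=1..k. hinner (S (T (f i))) (T (f i)))"
    by (simp only: S_def hinner_frame_operator_self)
  also have "\<dots> = (\<Sum>i=1..k. hinner (T (f i)) (f i))"
    by (simp add: S_T T_adj)
  \<comment> \<open>The matrix is a sum of rank-one terms, and the trace of \<open>N\<close> times
    the \<open>i\<close>-th term is the \<open>i\<close>-th summand; only the order of summation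
    changes.\<close>
  also have "\<dots> = trace (N ** frame_matrix k f)"
    by (simp add: T hinner_def trace_def matrix_matrix_mult_def matrix_vector_mult_def
        frame_matrix_def sum_distrib_left sum_distrib_right mult_ac sum.swap[of _ UNIV "{_.._}"])
  also have "\<dots> = of_real (real CARD('n))"
    by (simp add: NM trace_I)
  finally show ?thesis
    by (simp only: of_real_eq_iff)
qed

end

theorem proposition17:
  shows "(\<forall>(k::nat) (f :: nat \<Rightarrow> real ^ 'n).
            is_frame k f \<longrightarrow>
              cross_frame_potential k f (canonical_dual k f) = real CARD('n)) \<and>
         (\<forall>(k::nat) (f :: nat \<Rightarrow> complex ^ 'n).
            is_frame k f \<longrightarrow>
              cross_frame_potential k f (canonical_dual k f) = real CARD('n))"
proof (intro conjI allI impI)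
  fix k and f :: "nat \<Rightarrow> real ^ 'n"
  assume "is_frame k f"
  then show "cross_frame_potential k f (canonical_dual k f) = real CARD('n)"
    \<comment> \<open>Rotation lets the frame hypothesis be discharged first; what remains is
      \<open>norm_conjugate\<close>, here \<open>x * x = \<bar>x\<bar>\<^sup>2\<close>.\<close>
    by (rule cross_frame_potential_canonical_dual[rotated]) (simp add: power2_eq_square)
next
  fix k and f :: "nat \<Rightarrow> complex ^ 'n"
  assume "is_frame k f"
  then show "cross_frame_potential k f (canonical_dual k f) = real CARD('n)"
    by (rule cross_frame_potential_canonical_dual[rotated])
      (simp add: complex_mult_cnj cmod_def)
qed

end
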